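(* Consider the discretization $$F(U):=U-u^n+\Delta t_n\bigl(D\,\mathrm{diag}(U)\,U+\mathrm{diag}(U)\,D\,U\bigr)=0,\qquad u^{n+1}=2U-u^n,$$ of the inviscid Burgers equation $u_t+6uu_x=0$ on a one-dimensional periodic domain, where $D$ is a skew-symmetric matrix approximating the spatial derivative operator, namely the classical fourth-order accurate central finite difference matrix with periodic boundaries. Apply $k+1$ iterations of Newton's method to the stage equation $F(U)=0$, producing iterates $U^{(0)},\dots,U^{(k+1)}$, and let the resulting numerical solution be $u^{n+1}=2U^{(k+1)}-u^n$. Then the entropy of this numerical solution satisfies $$\eta(u^{n+1})=\eta(u^n)-2\,\Delta x\,\Delta t_n\,\Delta U^\top M\,\Delta U,$$ where $\Delta U=U^{(k+1)}-U^{(k)}$ and $M=\mathrm{diag}(DU^{(k)})+D\,\mathrm{diag}(U^{(k)})$. Thus, the entropy error $\eta(u^{n+1})-\eta(u^n)$ depends on the indefinite quadratic form $$\Delta U^\top M\,\Delta U=\Delta U^\top\bigl[\mathrm{diag}(DU^{(k)})+D\,\mathrm{diag}(U^{(k)})\bigr]\Delta U .$$ Consequently, Newton's method may cause both entropy growth and entropy decay.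
   Context: All vectors are grid functions on a uniform periodic grid with spacing $\Delta x>0$. The vector $u^n$ is the numerical solution at time $t_n$, and $\Delta t_n=t_{n+1}-t_n$ is the time step. For a vector $v$, $\mathrm{diag}(v)$ is the diagonal matrix with the entries of $v$ on its diagonal. The discrete norm is $\|v\|^2=\Delta x\,v^\top v$ and the discrete entropy is $\eta(v)=\tfrac12\|v\|^2$. The matrix $D$ is given by $(Dv)_i=\dfrac{v_{i-2}-8v_{i-1}+8v_{i+1}-v_{i+2}}{12\,\Delta x}$ with indices taken periodically; it satisfies $D^\top=-D$. The discretization is the implicit midpoint rule applied to the semi-discretization $u_t+2\bigl(D\,\mathrm{diag}(u)u+\mathrm{diag}(u)Du\bigr)=0$; if the stage equation $F(U)=0$ is solved exactly, then $\eta(u^{n+1})=\eta(u^n)$. Newton's method for $F(U)=0$ is the iteration $F'(U^{(j)})\,(U^{(j+1)}-U^{(j)})+F(U^{(j)})=0$, $j=0,1,\dots$, where $F'$ is the Jacobian of $F$.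
   Formalization: Indefiniteness of M is claimed only for non-constant U^(k) (for constant U^(k)=c, M=cD and the form vanishes identically), and indefiniteness and growth/decay only for grids of at least 5 points, so that the five stencil points are distinct. *)

theory Defs
  imports "HOL-Analysis.Analysis" "Berlekamp_Zassenhaus.Finite_Field"
begin

(* Grid points of the uniform periodic grid with N = CARD('n) points are the residues modulo N,
   so that index arithmetic such as i - 2 is periodic; a grid function is a vector
   of type real ^ 'n mod_ring. *)

definition diag :: "real ^ 'a \<Rightarrow> real ^ 'a ^ 'a" where
  "diag v = (\<chi> i j. if i = j then v $ i else 0)"

definition central_diff4 :: "real \<Rightarrow> real ^ 'n::nontriv mod_ring \<Rightarrow> real ^ 'n mod_ring" where
  "central_diff4 dx v =
     (\<chi> i. (v $ (i - 2) - 8 * v $ (i - 1) + 8 * v $ (i + 1) - v $ (i + 2)) / (12 * dx))"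

definition D_mat :: "real \<Rightarrow> real ^ 'n::nontriv mod_ring ^ 'n mod_ring" where
  "D_mat dx = matrix (central_diff4 dx)"

lemma linear_central_diff4: "linear (central_diff4 dx)"
  by (rule linearI)
     (auto simp: central_diff4_def vec_eq_iff algebra_simps add_divide_distrib diff_divide_distrib)

lemma D_mat_mult: "D_mat dx *v v = central_diff4 dx v"
  unfolding D_mat_def by (simp add: matrix_works linear_central_diff4)

lemma transpose_D_mat: "transpose (D_mat dx) = - D_mat dx"
  by (auto simp: vec_eq_iff transpose_def D_mat_def matrix_def central_diff4_def axis_def
      algebra_simps diff_eq_eq eq_diff_eq)

definition grid_norm :: "real \<Rightarrow> real ^ 'a \<Rightarrow> real" where
  "grid_norm dx v = sqrt (dx * (v \<bullet> v))"

definition entropy :: "real \<Rightarrow> real ^ 'a \<Rightarrow> real" where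
  "entropy dx v = 1 / 2 * (grid_norm dx v)\<^sup>2"

definition stage_residual ::
    "real \<Rightarrow> real \<Rightarrow> real ^ 'n::nontriv mod_ring \<Rightarrow> real ^ 'n mod_ring \<Rightarrow> real ^ 'n mod_ring" where
  "stage_residual dx dt un U =
     U - un + dt *\<^sub>R (D_mat dx *v (diag U *v U) + diag U *v (D_mat dx *v U))"

(* U 0, ..., U m result from m Newton steps with arbitrary initial guess U 0.  Each step is
   the linear equation itself, so singular Jacobians are not ruled out. *)
definition newton_iterates :: "(real ^ 'a \<Rightarrow> real ^ 'a) \<Rightarrow> nat \<Rightarrow> (nat \<Rightarrow> real ^ 'a) \<Rightarrow> bool" where
  "newton_iterates F m U \<longleftrightarrow>
     (\<forall>j<m. jacobian F (at (U j)) *v (U (Suc j) - U j) + F (U j) = 0)"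

definition M_mat :: "real \<Rightarrow> real ^ 'n::nontriv mod_ring \<Rightarrow> real ^ 'n mod_ring ^ 'n mod_ring" where
  "M_mat dx W = diag (D_mat dx *v W) + D_mat dx ** diag W"

definition indefinite :: "real ^ 'a ^ 'a \<Rightarrow> bool" where
  "indefinite A \<longleftrightarrow> (\<exists>v. v \<bullet> (A *v v) > 0) \<and> (\<exists>v. v \<bullet> (A *v v) < 0)"

end

theory Submission
  imports Defs
begin

text \<open>
  Write \<open>F U = U - un + dt Q(U)\<close> with the quadratic map \<open>Q(v) = B(v, v) = D(v v) + v D v\<close>. Skewness of
  \<open>D\<close> gives \<open>v \<bullet> Q(v) = 0\<close>, and \<open>F\<close> being quadratic, a Newton step \<open>d\<close> from \<open>U\<close> satisfies
  \<open>F (U + d) = dt Q(d)\<close>. Both together yield the entropy change \<open>2 dx dt (U \<bullet> Q(d))\<close>.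

  For the indefiniteness: \<open>M\<close> has trace zero, and its symmetric part has the off-diagonal entries
  \<open>(W (i+1) - W i) / (3 dx)\<close>, which do not all vanish.

  For both signs of the entropy change, start from \<open>\<epsilon> w\<close> with residual \<open>- \<epsilon>\<^sup>2 \<delta>\<^sub>0\<close>. As \<open>\<epsilon>\<close> tends to \<open>0\<close>,
  the Jacobians tend to the identity, and the \<open>j\<close>-th step is \<open>\<epsilon> ^ (2 ^ (j+1)) \<delta>\<^sub>j\<close> to leading order, where
  \<open>\<delta>\<^sub>j\<^sub>+\<^sub>1 = - dt Q(\<delta>\<^sub>j)\<close>. The sign of the entropy change is that of \<open>w \<bullet> Q(\<delta>\<^sub>k)\<close>, so \<open>w = \<plusminus> Q(\<delta>\<^sub>k)\<close>
  works as soon as \<open>Q(\<delta>\<^sub>k)\<close> is not \<open>0\<close>. To find \<open>\<delta>\<^sub>0\<close> whose orbit under \<open>Q\<close> never reaches \<open>0\<close>, take an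
  integer grid function that is an eigenfunction of \<open>12 dx Q\<close> modulo some prime, with an eigenvalue
  prime to it.
\<close>

subsection \<open>The entropy identity\<close>

lemma matrix_inv_right: "invertible A \<Longrightarrow> A ** matrix_inv A = mat 1"
  unfolding invertible_def matrix_inv_def by (rule someI2_ex) auto

section \<open>Skew-symmetry of the difference operator\<close>

lemma D_mat_nth: "D_mat dx $ i $ j = central_diff4 dx (axis j 1) $ i"
  by (simp add: D_mat_def matrix_def)

lemma D_mat_swap: "D_mat dx $ j $ i = - D_mat dx $ i $ j"
  using arg_cong[OF transpose_D_mat, of "\<lambda>A. A $ i $ j" dx] by (simp add: transpose_def)

text \<open>Discrete integration by parts; periodicity leaves no boundary terms.\<close>

lemma inner_central_diff4: "u \<bullet> central_diff4 dx v = - (central_diff4 dx u \<bullet> v)"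
proof -
  have "u \<bullet> (D_mat dx *v v) = (transpose (D_mat dx) *v u) \<bullet> v"
    by (metis dot_lmul_matrix transpose_matrix_vector)
  moreover have "(- D_mat dx) *v u = - (D_mat dx *v u)"
    by (simp add: vec_eq_iff matrix_vector_mult_def sum_negf)
  ultimately show ?thesis
    by (simp add: transpose_D_mat D_mat_mult)
qed

lemma inner_vec_mult: "(u * v) \<bullet> w = u \<bullet> (v * w)" for u v w :: "real ^ 'a"
  by (simp add: inner_vec_def mult.assoc)

lemma diag_mult_vec: "diag u *v v = u * v"
  by (simp add: vec_eq_iff diag_def matrix_vector_mult_def if_distrib if_distribR cong: if_cong)

lemma entropy_eq_inner: "dx > 0 \<Longrightarrow> entropy dx v = dx / 2 * (v \<bullet> v)"
  by (simp add: entropy_def grid_norm_def)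

lemma M_mat_mult: "M_mat dx W *v v = central_diff4 dx W * v + central_diff4 dx (W * v)"
  by (simp add: M_mat_def matrix_vector_mult_add_rdistrib diag_mult_vec D_mat_mult
      flip: matrix_vector_mul_assoc)

text \<open>Polarization of the quadratic map \<open>Q\<close>: its symmetry makes
  \<open>2 * burgers_form dx U\<close> the derivative of \<open>Q\<close> at
  \<open>U\<close>.\<close>

definition burgers_form ::
    "real \<Rightarrow> real ^ 'n::nontriv mod_ring \<Rightarrow> real ^ 'n mod_ring \<Rightarrow> real ^ 'n mod_ring" where
  "burgers_form dx u v =
     central_diff4 dx (u * v) + (1/2) *\<^sub>R (u * central_diff4 dx v + v * central_diff4 dx u)"

lemma burgers_form_self:
  "burgers_form dx v v = central_diff4 dx (v * v) + v * central_diff4 dx v"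
  by (simp add: burgers_form_def flip: scaleR_add_left)

lemma burgers_form_commute: "burgers_form dx u v = burgers_form dx v u"
  by (simp add: burgers_form_def algebra_simps)

lemma bounded_bilinear_burgers_form: "bounded_bilinear (burgers_form dx)"
proof -
  note lin = linear_add[OF linear_central_diff4] linear_scale[OF linear_central_diff4]
  have "bilinear (burgers_form dx)"
    unfolding bilinear_def
    by (auto intro!: linearI simp: burgers_form_def lin algebra_simps)
  then show ?thesis by (simp add: bilinear_conv_bounded_bilinear)
qed

text \<open>Moving \<open>D\<close> to the other factor turns the conservative term into minus the
  advective one. This is the entropy conservation of the split form.\<close>

lemma inner_burgers_form_self: "v \<bullet> burgers_form dx v v = 0"
proof -
  have "v \<bullet> central_diff4 dx (v * v) = - (v \<bullet> (v * central_diff4 dx v))"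
    by (metis inner_central_diff4 inner_commute inner_vec_mult)
  then show ?thesis
    by (simp add: burgers_form_self inner_add_right)
qed

text \<open>Integration by parts moves both derivatives off the quadratic argument, which is how
  \<open>M_mat\<close> arises, with \<open>u\<close> the iterate and \<open>v\<close> the Newton
  step.\<close>

lemma inner_burgers_form: "u \<bullet> burgers_form dx v v = - (v \<bullet> (M_mat dx u *v v))"
proof -
  have "u \<bullet> central_diff4 dx (v * v) = - (v \<bullet> (central_diff4 dx u * v))"
    by (metis inner_central_diff4 inner_commute inner_vec_mult)
  moreover have "u \<bullet> (v * central_diff4 dx v) = - (v \<bullet> central_diff4 dx (u * v))"
    by (metis inner_central_diff4 inner_commute inner_vec_mult)
  ultimately show ?thesis
    by (simp add: burgers_form_self M_mat_mult inner_add_right)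
qed

section \<open>Newton steps for the quadratic stage residual\<close>

lemma stage_residual_eq: "stage_residual dx dt un U = U - un + dt *\<^sub>R burgers_form dx U U"
  by (simp add: stage_residual_def burgers_form_self D_mat_mult diag_mult_vec)

lemma jacobian_stage_residual:
  "jacobian (stage_residual dx dt un) (at U) *v h = h + (2 * dt) *\<^sub>R burgers_form dx U h"
proof -
  have "(stage_residual dx dt un has_derivative
          (\<lambda>h. h + (2 * dt) *\<^sub>R burgers_form dx U h)) (at U)"
    unfolding stage_residual_eq[abs_def]
    by (rule has_derivative_eq_rhs, (rule derivative_intros bounded_bilinear.FDERIV[OF bounded_bilinear_burgers_form])+)
       (auto simp: burgers_form_commute[of dx _ U] fun_eq_iff simp flip: scaleR_2 )
  then show ?thesis
    by (simp add: jacobian_def matrix_works has_derivative_linear flip: frechet_derivative_at)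
qed

text \<open>The second-order Taylor expansion is exact here, and the Newton equation cancels its
  constant and linear parts.\<close>

lemma stage_residual_newton:
  assumes "jacobian (stage_residual dx dt un) (at U) *v d + stage_residual dx dt un U = 0"
  shows "stage_residual dx dt un (U + d) = dt *\<^sub>R burgers_form dx d d"
proof -
  interpret bounded_bilinear "burgers_form dx" by (rule bounded_bilinear_burgers_form)
  have "burgers_form dx (U + d) (U + d)
      = burgers_form dx U U + 2 *\<^sub>R burgers_form dx U d + burgers_form dx d d"
    by (simp add: add_left add_right burgers_form_commute[of dx d U] scaleR_2)
  with assms show ?thesis
    by (simp add: jacobian_stage_residual stage_residual_eq algebra_simps)
qed

text \<open>With \<open>V = U + d\<close>, the entropy change is \<open>2 * dx\<close> times the
  inner product of \<open>V\<close> and \<open>V - un\<close>. The term \<open>Q(V)\<close> in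
  \<open>V - un\<close> is orthogonal to \<open>V\<close>, and \<open>Q(d)\<close> is orthogonal to
  \<open>d\<close>, so that only \<open>U\<close> is left against \<open>Q(d)\<close>.\<close>

lemma entropy_newton:
  assumes "dx > 0"
    and "jacobian (stage_residual dx dt un) (at U) *v d + stage_residual dx dt un U = 0"
  shows "entropy dx (2 *\<^sub>R (U + d) - un) = entropy dx un + 2 * dx * dt * (U \<bullet> burgers_form dx d d)"
proof -
  let ?V = "U + d" and ?Q = "\<lambda>v. burgers_form dx v v"
  have "?V - un = dt *\<^sub>R ?Q d - dt *\<^sub>R ?Q ?V"
    using stage_residual_newton[OF assms(2)] by (simp add: stage_residual_eq algebra_simps)
  then have "?V \<bullet> (?V - un) = dt * (U \<bullet> ?Q d)"
    by (simp add: inner_diff_right inner_burgers_form_self)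
       (simp add: inner_add_left inner_burgers_form_self)
  moreover have "(2 *\<^sub>R ?V - un) \<bullet> (2 *\<^sub>R ?V - un) = un \<bullet> un + 4 * (?V \<bullet> (?V - un))"
    by (simp add: algebra_simps inner_commute)
  ultimately show ?thesis
    using assms(1) by (simp add: entropy_eq_inner algebra_simps)
qed

subsection \<open>Indefiniteness\<close>

lemma of_nat_mod_ring_eq_0_iff: "(of_nat m :: 'n::nontriv mod_ring) = 0 \<longleftrightarrow> CARD('n) dvd m"
proof -
  have "(of_nat m :: 'n mod_ring) = of_int_mod_ring (int m)"
    by (simp add: of_nat_of_int_mod_ring)
  then show ?thesis
    by transfer (auto simp: dvd_eq_mod_eq_0 simp flip: zmod_int)
qed

text \<open>The residue 1 generates all grid points, so equality of neighbours propagates. The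
  contrapositive supplies adjacent points with different values.\<close>

lemma grid_function_const:
  fixes W :: "real ^ 'n::nontriv mod_ring"
  assumes "\<And>i. W $ (i + 1) = W $ i"
  shows "W $ i = W $ j"
proof -
  have *: "W $ of_nat m = W $ 0" for m
    by (induction m) (simp_all add: assms add.commute[of 1])
  have "\<exists>m. i = of_nat m" for i :: "'n mod_ring"
    by (rule exI[of _ "nat (to_int_mod_ring i)"])
       (simp add: of_nat_of_int_mod_ring, transfer, simp)
  then show ?thesis using * by metis
qed

text \<open>If some diagonal entry is nonzero, the vanishing trace forces diagonal entries of both
  signs. Otherwise two adjacent unit vectors span a plane on which the form is a nonzero multiple of
  the product of the coordinates.\<close>

lemma indefinite_M_mat:
  fixes W :: "real ^ 'n::nontriv mod_ring"
  assumes "dx > 0" "CARD('n) \<ge> 5" and nonconst: "W $ i0 \<noteq> W $ j0"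
  shows "indefinite (M_mat dx W)"
proof -
  define e :: "'n mod_ring \<Rightarrow> real ^ 'n mod_ring" where "e = (\<lambda>i. axis i 1)"
  let ?q = "\<lambda>v. v \<bullet> (M_mat dx W *v v)"
  have M: "e i \<bullet> (M_mat dx W *v e j)
      = (if i = j then central_diff4 dx W $ i else 0) + D_mat dx $ i $ j * W $ j" for i j
  proof -
    have "W * e j = W $ j *\<^sub>R e j"
      by (simp add: vec_eq_iff e_def axis_def)
    moreover have "e i \<bullet> x = x $ i" for x
      by (simp add: e_def inner_axis')
    ultimately show ?thesis
      by (simp add: M_mat_mult linear_scale[OF linear_central_diff4] D_mat_nth)
         (simp add: e_def axis_def)
  qed
  have D_diag: "D_mat dx $ i $ i = 0" for i :: "'n mod_ring"
    using D_mat_swap[of dx i i] by simp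
  have q_e: "?q (e i) = central_diff4 dx W $ i" for i
    by (simp add: M D_diag)
  have trace: "(\<Sum>i\<in>UNIV. ?q (e i)) = 0"
  proof -
    \<comment> \<open>By skewness this sum is minus the inner product of \<open>D 1\<close> with
      \<open>W\<close>, and \<open>D\<close> annihilates constants.\<close>
    have "(\<Sum>i\<in>UNIV. central_diff4 dx W $ i) = 1 \<bullet> central_diff4 dx W"
      by (simp add: inner_vec_def)
    also have "\<dots> = 0"
      by (subst inner_central_diff4) (simp add: central_diff4_def inner_vec_def)
    finally show ?thesis by (simp add: q_e)
  qed
  show ?thesis
  proof (cases "\<forall>i. ?q (e i) = 0")
    case False
    have "\<exists>i. ?q (e i) > 0"
    proof (rule ccontr)
      assume "\<nexists>i. ?q (e i) > 0"
      then have "\<forall>i\<in>UNIV. ?q (e i) = 0"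
        using sum_nonneg_eq_0_iff[of UNIV "\<lambda>i. - ?q (e i)"] trace
        by (simp add: not_less sum_negf)
      with False show False by simp
    qed
    moreover have "\<exists>i. ?q (e i) < 0"
    proof (rule ccontr)
      assume "\<nexists>i. ?q (e i) < 0"
      then have "\<forall>i\<in>UNIV. ?q (e i) = 0"
        using sum_nonneg_eq_0_iff[of UNIV "\<lambda>i. ?q (e i)"] trace by (simp add: not_less)
      with False show False by simp
    qed
    ultimately show ?thesis unfolding indefinite_def by blast
  next
    case True
    obtain i where i: "W $ (i + 1) \<noteq> W $ i"
      using grid_function_const nonconst by blast
    \<comment> \<open>The points \<open>i - 2\<close>, \<open>i - 1\<close> and \<open>i + 2\<close>
      differ from \<open>i + 1\<close> by 3, 2 and 1, so only the weight 8 contributes to the entry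
      at \<open>(i, i + 1)\<close>.\<close>
    have "(of_nat m :: 'n mod_ring) \<noteq> 0" if "m \<in> {1,2,3}" for m
      using that assms(2) by (auto simp: of_nat_mod_ring_eq_0_iff dest!: dvd_imp_le)
    from this[of 1] this[of 2] this[of 3]
    have ne: "(1 :: 'n mod_ring) \<noteq> 0" "(2 :: 'n mod_ring) \<noteq> 0" "(3 :: 'n mod_ring) \<noteq> 0"
      by simp_all
    have D: "D_mat dx $ i $ (i + 1) = 8 / (12 * dx)"
    proof -
      have "(i + 1) - (i - 2) = 3" "(i + 1) - (i - 1) = 2" "(i + 2) - (i + 1) = 1"
        by simp_all
      then have "i - 2 \<noteq> i + 1" "i - 1 \<noteq> i + 1" "i + 2 \<noteq> i + 1"
        using ne by (metis diff_self)+
      then show ?thesis by (simp add: D_mat_nth central_diff4_def axis_def)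
    qed
    define c where "c = (W $ (i + 1) - W $ i) * (8 / (12 * dx))"
    have q: "?q (e i + s *\<^sub>R e (i + 1)) = s * c" for s
    proof -
      have "?q (e i + s *\<^sub>R e (i + 1)) = ?q (e i) + s\<^sup>2 * ?q (e (i + 1))
          + s * (e i \<bullet> (M_mat dx W *v e (i + 1)) + e (i + 1) \<bullet> (M_mat dx W *v e i))"
        by (simp add: matrix_vector_right_distrib matrix_vector_mult_scaleR
            algebra_simps power2_eq_square)
      also have "\<dots> = s * c"
      proof -
        have "i + 1 \<noteq> i" using ne(1) by simp
        then have "e i \<bullet> (M_mat dx W *v e (i + 1)) + e (i + 1) \<bullet> (M_mat dx W *v e i) = c"
          unfolding M D_mat_swap[of dx "i + 1" i] D c_def by (simp add: left_diff_distrib mult.commute diff_divide_distrib)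
        with True show ?thesis by simp
      qed
      finally show ?thesis .
    qed
    have "c \<noteq> 0" using i assms(1) by (simp add: c_def)
    \<comment> \<open>The values are the square of \<open>c\<close> and its negative.\<close>
    then have "?q (e i + c *\<^sub>R e (i + 1)) > 0" "?q (e i + (- c) *\<^sub>R e (i + 1)) < 0"
      unfolding q by (simp_all add: zero_less_mult_iff linorder_neq_iff disj_commute)
    then show ?thesis unfolding indefinite_def by blast
  qed
qed

subsection \<open>Nonvanishing orbits of the quadratic map\<close>

text \<open>Equal to \<open>12 dx Q\<close>, which makes it integral.\<close>
definition int_burgers :: "(int \<Rightarrow> int) \<Rightarrow> int \<Rightarrow> int" where
  "int_burgers f x =
     ((f (x - 2))\<^sup>2 - 8 * (f (x - 1))\<^sup>2 + 8 * (f (x + 1))\<^sup>2 - (f (x + 2))\<^sup>2)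
     + f x * (f (x - 2) - 8 * f (x - 1) + 8 * f (x + 1) - f (x + 2))"

section \<open>Periodic integer functions as grid functions\<close>

definition grid_of :: "(int \<Rightarrow> int) \<Rightarrow> real ^ 'n::nontriv mod_ring" where
  "grid_of f = (\<chi> i. of_int (f (to_int_mod_ring i)))"

text \<open>Stated through \<open>mod\<close>, so that it removes directly the reductions that index
  arithmetic in \<open>mod_ring\<close> produces.\<close>

definition int_periodic :: "int \<Rightarrow> (int \<Rightarrow> int) \<Rightarrow> bool" where
  "int_periodic d f \<longleftrightarrow> (\<forall>x. f (x mod d) = f x)"

lemma int_periodic_mod_add: "int_periodic d f \<Longrightarrow> f (x mod d + c) = f (x + c)"
  unfolding int_periodic_def by (metis mod_add_left_eq)

lemma int_periodic_mod_diff: "int_periodic d f \<Longrightarrow> f (x mod d - c) = f (x - c)"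
  unfolding int_periodic_def by (metis mod_diff_left_eq)

lemma int_burgers_mod:
  "int_periodic d f \<Longrightarrow> int_burgers f (x mod d) = int_burgers f x"
  by (simp add: int_burgers_def int_periodic_mod_add int_periodic_mod_diff)
     (simp add: int_periodic_def)

lemma int_periodic_int_burgers: "int_periodic d f \<Longrightarrow> int_periodic d (int_burgers f)"
  by (simp add: int_periodic_def[of d "int_burgers f"] int_burgers_mod)

lemma int_periodic_dvd: "int_periodic d f \<Longrightarrow> d dvd n \<Longrightarrow> int_periodic n f"
  unfolding int_periodic_def by (metis mod_mod_cancel)

lemma to_int_mod_ring_add_1:
  "to_int_mod_ring (i + 1 :: 'n::nontriv mod_ring) = (to_int_mod_ring i + 1) mod int CARD('n)"
  by transfer simp

lemma to_int_mod_ring_diff_1: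
  "to_int_mod_ring (i - 1 :: 'n::nontriv mod_ring) = (to_int_mod_ring i - 1) mod int CARD('n)"
  by transfer simp

text \<open>Periodicity hides the wrap-around of the indices, so the stencil may be evaluated on
  unreduced integers.\<close>

lemma burgers_form_grid_of:
  assumes "int_periodic (int CARD('n)) f"
  shows "burgers_form dx (grid_of f) (grid_of f :: real ^ 'n::nontriv mod_ring)
    = (1 / (12 * dx)) *\<^sub>R grid_of (int_burgers f)"
proof -
  let ?t = "to_int_mod_ring :: 'n mod_ring \<Rightarrow> int"
  have f: "f (x mod int CARD('n)) = f x" for x
    using assms by (simp add: int_periodic_def)
  have p1: "f (?t (i + 1)) = f (?t i + 1)" and m1: "f (?t (i - 1)) = f (?t i - 1)" for i
    by (simp_all add: to_int_mod_ring_add_1 to_int_mod_ring_diff_1 f)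
  have p2: "f (?t (i + 2)) = f (?t i + 2)" for i
  proof -
    have "i + 2 = (i + 1) + 1" by simp
    then have "f (?t (i + 2)) = f (?t (i + 1) + 1)" by (metis p1)
    also have "\<dots> = f (?t i + 2)"
      unfolding to_int_mod_ring_add_1 int_periodic_mod_add[OF assms] by (simp add: add.assoc)
    finally show ?thesis .
  qed
  have m2: "f (?t (i - 2)) = f (?t i - 2)" for i
  proof -
    have "i - 2 = (i - 1) - 1" by simp
    then have "f (?t (i - 2)) = f (?t (i - 1) - 1)" by (metis m1)
    also have "\<dots> = f (?t i - 2)"
      unfolding to_int_mod_ring_diff_1 int_periodic_mod_diff[OF assms] by (simp add: diff_diff_eq)
    finally show ?thesis .
  qed
  show ?thesis
    by (simp add: vec_eq_iff burgers_form_self central_diff4_def grid_of_def int_burgers_def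
        p1 m1 p2 m2 power2_eq_square add_divide_distrib)
qed

lemma int_burgers_scale: "int_burgers (\<lambda>x. s * f x) x = s\<^sup>2 * int_burgers f x"
  by (simp add: int_burgers_def algebra_simps power2_eq_square)

lemma int_burgers_cong:
  assumes "\<And>x. [f x = g x] (mod q)"
  shows "[int_burgers f x = int_burgers g x] (mod q)"
  unfolding int_burgers_def
  by (intro cong_add cong_diff cong_mult cong_pow cong_refl assms)

text \<open>Up to a nonzero real factor, each \<open>\<delta> j\<close> comes from an integer
  function congruent to \<open>s * f\<close> modulo \<open>q\<close>, with \<open>s\<close> prime to
  \<open>q\<close>. One application of the quadratic map replaces \<open>s\<close> by
  \<open>s\<^sup>2 * c\<close>, which is again prime to \<open>q\<close>.\<close>

lemma int_burgers_orbit: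
  fixes \<delta> :: "nat \<Rightarrow> real ^ 'n::nontriv mod_ring" and q :: int
  assumes "prime q" "\<not> q dvd c" "a \<noteq> 0" "dx \<noteq> 0"
    and f: "int_periodic (int CARD('n)) f" "\<not> q dvd f 1"
    and eig: "\<And>x. [int_burgers f x = c * f x] (mod q)"
    and \<delta>: "\<delta> 0 = grid_of f" "\<And>j. \<delta> (Suc j) = a *\<^sub>R burgers_form dx (\<delta> j) (\<delta> j)"
  shows "\<delta> j \<noteq> 0"
proof -
  have "\<exists>b g s. b \<noteq> 0 \<and> int_periodic (int CARD('n)) g \<and> \<not> q dvd s \<and>
      (\<forall>x. [g x = s * f x] (mod q)) \<and> \<delta> j = b *\<^sub>R grid_of g"
  proof (induction j)
    case 0
    then show ?case
      using assms(1) f \<delta>(1) by (intro exI[of _ 1] exI[of _ f]) (auto simp: not_prime_unit)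
  next
    case (Suc j)
    then obtain b g s where g: "b \<noteq> 0" "int_periodic (int CARD('n)) g" "\<not> q dvd s"
      "\<And>x. [g x = s * f x] (mod q)" "\<delta> j = b *\<^sub>R grid_of g"
      by blast
    interpret bounded_bilinear "burgers_form dx" by (rule bounded_bilinear_burgers_form)
    have "[int_burgers g x = (s\<^sup>2 * c) * f x] (mod q)" for x
    proof -
      have "[int_burgers g x = s\<^sup>2 * int_burgers f x] (mod q)"
        using int_burgers_cong[of g "\<lambda>x. s * f x" q x, OF g(4)] by (simp only: int_burgers_scale)
      also have "[s\<^sup>2 * int_burgers f x = s\<^sup>2 * (c * f x)] (mod q)"
        by (intro cong_mult cong_refl eig)
      finally show ?thesis by (simp add: mult.assoc)
    qed
    moreover have "\<not> q dvd s\<^sup>2 * c"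
      using g(3) assms(1,2) by (simp add: prime_dvd_mult_iff prime_dvd_power_iff)
    moreover have "\<delta> (Suc j) = (a * (b * b / (12 * dx))) *\<^sub>R grid_of (int_burgers g)"
      by (simp add: \<delta>(2) g(5) scaleR_left scaleR_right burgers_form_grid_of[OF g(2)])
    ultimately show ?case
      using int_periodic_int_burgers[OF g(2)] assms(3,4) g(1)
      by (intro exI[of _ "a * (b * b / (12 * dx))"] exI[of _ "int_burgers g"] exI[of _ "s\<^sup>2 * c"])
         simp
  qed
  then obtain b g s where g: "b \<noteq> 0" "\<not> q dvd s" "[g 1 = s * f 1] (mod q)" "\<delta> j = b *\<^sub>R grid_of g"
    by blast
  \<comment> \<open>The function is tested at 1, since the identity, one of the eigenfunctions in
    use, vanishes at 0.\<close>
  have "\<not> q dvd g 1"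
    using g(2,3) f(2) assms(1) by (simp add: cong_dvd_iff prime_dvd_mult_iff)
  then have "(grid_of g :: real ^ 'n mod_ring) $ 1 \<noteq> 0"
    by (auto simp: grid_of_def)
  then show ?thesis
    using g(1,4) by auto
qed

text \<open>By periodicity the congruence need only be checked on one period, a finite
  computation.\<close>

lemma table_eigenfunction:
  fixes xs :: "int list"
  defines "f \<equiv> \<lambda>x. xs ! nat (x mod int (length xs))"
  assumes "xs \<noteq> []" "int (length xs) dvd n"
    and "\<forall>r \<in> set [0..int (length xs) - 1]. int_burgers f r mod q = c * f r mod q"
  shows "int_periodic n f" "[int_burgers f x = c * f x] (mod q)"
proof -
  have per: "int_periodic (int (length xs)) f"
    by (simp add: int_periodic_def f_def)
  then show "int_periodic n f"
    using assms(3) by (rule int_periodic_dvd)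
  have "x mod int (length xs) \<in> set [0..int (length xs) - 1]"
    using assms(2) by auto
  then have "[int_burgers f (x mod int (length xs)) = c * f (x mod int (length xs))] (mod q)"
    using assms(4) by (simp only: cong_def)
  then show "[int_burgers f x = c * f x] (mod q)"
    using per by (simp add: int_burgers_mod) (simp add: int_periodic_def)
qed

text \<open>Without prime factors above 3 and without the factors 4 and 9, a number divides
  6.\<close>

lemma divisor_cases:
  fixes n :: nat
  assumes "n \<ge> 5"
  obtains p where "prime p" "p \<ge> 5" "p dvd n" | "4 dvd n" | "9 dvd n" | "n = 6"
proof -
  have "n = 6" if no: "\<And>p. prime p \<Longrightarrow> p dvd n \<Longrightarrow> p < 5" "\<not> 4 dvd n" "\<not> 9 dvd n"
  proof -
    \<comment> \<open>A prime factor of \<open>m\<close> can only be 2 or 3. It then divides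
      \<open>gcd n 6\<close> as well, so its square divides \<open>n\<close>, which is
      excluded.\<close>
    define m where "m = n div gcd n 6"
    have n: "n = gcd n 6 * m" by (simp add: m_def)
    have "m = 1"
    proof (rule ccontr)
      assume "m \<noteq> 1"
      then obtain p where p: "prime p" "p dvd m" using prime_factor_nat by blast
      have "p dvd n" using p(2) n by (metis dvd_mult)
      then have "p < 5" using no(1) p(1) by blast
      moreover have "p \<noteq> 0" "p \<noteq> 1" "p \<noteq> 4"
        using p(1) prime_product[of 2 "2 :: nat"] by auto
      ultimately have "p = 2 \<or> p = 3" by linarith
      then have "p dvd gcd n 6" using \<open>p dvd n\<close> by auto
      then have "p * p dvd n" using p(2) n by (metis mult_dvd_mono)
      then show False using \<open>p = 2 \<or> p = 3\<close> no(2,3) by auto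
    qed
    then have "n dvd 6" using n by (metis gcd_dvd2 mult.right_neutral)
    then have "n \<le> 6" by (simp add: dvd_imp_le)
    then show ?thesis using assms \<open>n dvd 6\<close> by (cases "n = 5") auto
  qed
  then show ?thesis using that by (metis not_le)
qed

text \<open>
  If a prime \<open>p \<ge> 5\<close> divides the number of grid points, then the identity on the residues modulo \<open>p\<close> is an
  eigenfunction, since the stencil is exact on quadratic polynomials. The tables of period 4, 6 and 9
  that cover the remaining cases were found by a search modulo 5.
\<close>
lemma int_burgers_eigenfunction:
  fixes n :: nat
  assumes "n \<ge> 5"
  obtains f c and q :: int where "prime q" "\<not> q dvd c" "int_periodic (int n) f" "\<not> q dvd f 1"
    "\<And>x. [int_burgers f x = c * f x] (mod q)"
  using assms
proof (cases rule: divisor_cases)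
  case (1 p)
  \<comment> \<open>The jump of \<open>?f\<close> at the wrap-around is \<open>n\<close>, a multiple
    of \<open>p\<close>, and so invisible modulo \<open>p\<close>.\<close>
  let ?f = "\<lambda>x. x mod int n"
  have f: "[?f x = x] (mod int p)" for x
    using 1(3) by (simp add: cong_def mod_mod_cancel)
  then have "[int_burgers ?f x = int_burgers (\<lambda>x. x) x] (mod int p)" for x
    by (rule int_burgers_cong)
  moreover have "[36 * x = 36 * ?f x] (mod int p)" for x
    by (rule cong_mult[OF cong_refl cong_sym[OF f]])
  \<comment> \<open>The eigenvalue is \<open>12 * 3\<close>: the derivative of the square of
    \<open>x\<close> plus \<open>x\<close> times the derivative of \<open>x\<close> is
    \<open>3 * x\<close>.\<close>
  moreover have "int_burgers (\<lambda>x. x) x = 36 * x" for x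
    by (simp add: int_burgers_def power2_eq_square algebra_simps)
  ultimately have "[int_burgers ?f x = 36 * ?f x] (mod int p)" for x
    by (metis cong_trans)
  moreover have "\<not> int p dvd 36"
  proof
    assume "int p dvd 36"
    then have "p dvd 2\<^sup>2 * 3\<^sup>2" using of_nat_dvd_iff[of p 36, where 'a = int] by simp
    then have "p dvd 2 \<or> p dvd 3" using 1(1) by (metis prime_dvd_mult_nat prime_dvd_power)
    then show False using 1(2) by (auto dest: dvd_imp_le)
  qed
  ultimately show ?thesis
    using that[of "int p" 36 ?f] 1(1,2) assms by (simp add: int_periodic_def zmod_trivial_iff)
next
  case 2
  define f where "f = (\<lambda>x. [1,2,3,4] ! nat (x mod int (length [1,2,3,4 :: int])) :: int)"
  have "int_burgers f r mod 5 = 3 * f r mod 5" if "r \<in> {0,1,2,3}" for r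
    using that by (auto simp: f_def int_burgers_def)
  then have "int_periodic (int n) f" "[int_burgers f x = 3 * f x] (mod 5)" for x
    using 2 of_nat_dvd_iff[of 4 n, where 'a = int]
      table_eigenfunction[of "[1,2,3,4]" "int n" 5 3]
    unfolding f_def by (simp_all add: upto.simps)
  moreover have "\<not> 5 dvd f 1" by (simp add: f_def)
  ultimately show ?thesis
    using that[of 5 3 f] by simp
next
  case 3
  define f where "f = (\<lambda>x. [0,1,4,3,3,2,2,1,4] ! nat (x mod int (length [0,1,4,3,3,2,2,1,4 :: int])) :: int)"
  have "int_burgers f r mod 5 = 3 * f r mod 5" if "r \<in> {0,1,2,3,4,5,6,7,8}" for r
    using that by (auto simp: f_def int_burgers_def)
  then have "int_periodic (int n) f" "[int_burgers f x = 3 * f x] (mod 5)" for x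
    using 3 of_nat_dvd_iff[of 9 n, where 'a = int]
      table_eigenfunction[of "[0,1,4,3,3,2,2,1,4]" "int n" 5 3]
    unfolding f_def by (simp_all add: upto.simps)
  moreover have "\<not> 5 dvd f 1" by (simp add: f_def)
  ultimately show ?thesis
    using that[of 5 3 f] by simp
next
  case 4
  define f where "f = (\<lambda>x. [0,1,2,3,4,0] ! nat (x mod int (length [0,1,2,3,4,0 :: int])) :: int)"
  have "int_burgers f r mod 5 = 1 * f r mod 5" if "r \<in> {0,1,2,3,4,5}" for r
    using that by (auto simp: f_def int_burgers_def)
  then have "int_periodic (int n) f" "[int_burgers f x = 1 * f x] (mod 5)" for x
    using 4 of_nat_dvd_iff[of 6 n, where 'a = int]
      table_eigenfunction[of "[0,1,2,3,4,0]" "int n" 5 1]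
    unfolding f_def by (simp_all add: upto.simps)
  moreover have "\<not> 5 dvd f 1" by (simp add: f_def)
  ultimately show ?thesis
    using that[of 5 1 f] by simp
qed

subsection \<open>Newton steps for small data\<close>

text \<open>The Jacobian is the identity plus a perturbation of norm at most
  \<open>?\<kappa>\<close>, which tends to 0. Below \<open>1/2\<close> it is invertible with inverse
  bounded by 2, and the Newton step agrees with minus the residual to leading order.\<close>

lemma small_newton_step:
  fixes u r :: "real \<Rightarrow> real ^ 'n::nontriv mod_ring" and m :: "real \<Rightarrow> real"
  assumes u: "(u \<longlongrightarrow> 0) F" and r: "((\<lambda>\<epsilon>. r \<epsilon> /\<^sub>R m \<epsilon>) \<longlongrightarrow> - \<delta>) F"
    and J: "\<And>\<epsilon> h. J \<epsilon> *v h = h + t *\<^sub>R burgers_form dx (u \<epsilon>) h"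
  shows "eventually (\<lambda>\<epsilon>. invertible (J \<epsilon>)) F"
    and "((\<lambda>\<epsilon>. (- (matrix_inv (J \<epsilon>) *v r \<epsilon>)) /\<^sub>R m \<epsilon>) \<longlongrightarrow> \<delta>) F"
proof -
  interpret bounded_bilinear "burgers_form dx :: real ^ 'n mod_ring \<Rightarrow> _"
    by (rule bounded_bilinear_burgers_form)
  from pos_bounded obtain K where K: "K > 0"
    and "\<forall>v h. norm (burgers_form dx (v :: real ^ 'n mod_ring) h) \<le> norm v * norm h * K"
    by (elim exE conjE) (rule that)
  then have K_bound: "norm (burgers_form dx v h) \<le> norm v * norm h * K"
    for v h :: "real ^ 'n mod_ring"
    by (elim allE)
  let ?\<kappa> = "\<lambda>\<epsilon>. \<bar>t\<bar> * (norm (u \<epsilon>) * K)"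
  have \<kappa>: "norm (t *\<^sub>R burgers_form dx (u \<epsilon>) h) \<le> ?\<kappa> \<epsilon> * norm h" for \<epsilon> h
    using mult_left_mono[OF K_bound[of "u \<epsilon>" h] abs_ge_zero[of t]] by (simp add: mult_ac)
  have \<kappa>_lim: "(?\<kappa> \<longlongrightarrow> 0) F"
    using u by (auto intro!: tendsto_eq_intros)
  have ev: "eventually (\<lambda>\<epsilon>. ?\<kappa> \<epsilon> < 1/2) F"
    using order_tendstoD(2)[OF \<kappa>_lim, of "1/2"] by simp
  have inj: "norm h \<le> 2 * norm (J \<epsilon> *v h)" if "?\<kappa> \<epsilon> < 1/2" for \<epsilon> h
  proof -
    have "norm h \<le> norm (J \<epsilon> *v h) + norm (t *\<^sub>R burgers_form dx (u \<epsilon>) h)"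
      unfolding J using norm_triangle_ineq4[of "h + t *\<^sub>R burgers_form dx (u \<epsilon>) h"
          "t *\<^sub>R burgers_form dx (u \<epsilon>) h"] by simp
    moreover have "?\<kappa> \<epsilon> * norm h \<le> 1/2 * norm h"
      using that by (intro mult_right_mono) auto
    ultimately show ?thesis using \<kappa>[of \<epsilon> h] by linarith
  qed
  have inv: "invertible (J \<epsilon>)" if "?\<kappa> \<epsilon> < 1/2" for \<epsilon>
  proof -
    have "\<forall>h. J \<epsilon> *v h = 0 \<longrightarrow> h = 0"
      using inj[OF that] by (metis norm_le_zero_iff norm_zero mult_zero_right)
    then show ?thesis
      by (metis invertible_left_inverse matrix_left_invertible_ker)
  qed
  with ev show "eventually (\<lambda>\<epsilon>. invertible (J \<epsilon>)) F"
    by (auto elim: eventually_mono)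
  let ?x = "\<lambda>\<epsilon>. (- (matrix_inv (J \<epsilon>) *v r \<epsilon>)) /\<^sub>R m \<epsilon>" and ?y = "\<lambda>\<epsilon>. - (r \<epsilon> /\<^sub>R m \<epsilon>)"
  have y: "(?y \<longlongrightarrow> \<delta>) F"
    using tendsto_minus[OF r] by simp
  \<comment> \<open>Since \<open>J\<close> maps \<open>?x\<close> to \<open>?y\<close>, their
    difference is the perturbation applied to \<open>?x\<close>, whose norm is at most twice that of
    \<open>?y\<close>.\<close>
  have "eventually (\<lambda>\<epsilon>. norm (?x \<epsilon> - ?y \<epsilon>) \<le> ?\<kappa> \<epsilon> * (2 * norm (?y \<epsilon>))) F"
    using ev
  proof eventually_elim
    case (elim \<epsilon>)
    have "J \<epsilon> *v (matrix_inv (J \<epsilon>) *v r \<epsilon>) = r \<epsilon>"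
      using matrix_inv_right[OF inv[OF elim]] by (simp add: matrix_vector_mul_assoc)
    then have Jx: "J \<epsilon> *v ?x \<epsilon> = ?y \<epsilon>"
      by (simp add: matrix_vector_mult_scaleR linear_neg[OF matrix_vector_mul_linear])
    then have "?x \<epsilon> - ?y \<epsilon> = - (t *\<^sub>R burgers_form dx (u \<epsilon>) (?x \<epsilon>))"
      by (simp only: J) (metis add_diff_cancel_left' minus_diff_eq)
    then have "norm (?x \<epsilon> - ?y \<epsilon>) \<le> ?\<kappa> \<epsilon> * norm (?x \<epsilon>)"
      using \<kappa>[of \<epsilon> "?x \<epsilon>"] by (simp only: norm_minus_cancel)
    also have "\<dots> \<le> ?\<kappa> \<epsilon> * (2 * norm (?y \<epsilon>))"
      using inj[OF elim, of "?x \<epsilon>"] K unfolding Jx by (intro mult_left_mono) auto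
    finally show ?case .
  qed
  moreover have "((\<lambda>\<epsilon>. ?\<kappa> \<epsilon> * (2 * norm (?y \<epsilon>))) \<longlongrightarrow> 0) F"
    by (rule tendsto_eq_rhs[OF tendsto_mult[OF \<kappa>_lim tendsto_mult[OF tendsto_const tendsto_norm[OF y]]]]) simp
  ultimately have "((\<lambda>\<epsilon>. ?x \<epsilon> - ?y \<epsilon>) \<longlongrightarrow> 0) F"
    by (rule Lim_null_comparison)
  from tendsto_add[OF this y] show "(?x \<longlongrightarrow> \<delta>) F" by simp
qed

text \<open>The factor \<open>s\<close> allows entropy growth and decay to be treated
  together.\<close>

lemma newton_entropy_sign:
  fixes \<delta> :: "nat \<Rightarrow> real ^ 'n::nontriv mod_ring"
  assumes "dx > 0"
    and \<delta>: "\<And>j. \<delta> (Suc j) = (- dt) *\<^sub>R burgers_form dx (\<delta> j) (\<delta> j)"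
    and w: "s * (dt * (w \<bullet> burgers_form dx (\<delta> k) (\<delta> k))) > 0"
  shows "\<exists>(un :: real ^ 'n mod_ring) U. newton_iterates (stage_residual dx dt un) (k + 1) U \<and>
    (\<forall>j\<le>k. invertible (jacobian (stage_residual dx dt un) (at (U j)))) \<and>
    s * (entropy dx (2 *\<^sub>R U (k + 1) - un) - entropy dx un) > 0"
proof -
  interpret bounded_bilinear "burgers_form dx :: real ^ 'n mod_ring \<Rightarrow> _"
    by (rule bounded_bilinear_burgers_form)
  \<comment> \<open>Solved for \<open>un\<close> so that the residual at
    \<open>\<epsilon> *\<^sub>R w\<close> is exactly
    \<open>- (\<epsilon>\<^sup>2 *\<^sub>R \<delta> 0)\<close>.\<close>
  define un where "un = (\<lambda>\<epsilon>. \<epsilon> *\<^sub>R w + dt *\<^sub>R burgers_form dx (\<epsilon> *\<^sub>R w) (\<epsilon> *\<^sub>R w) + \<epsilon>\<^sup>2 *\<^sub>R \<delta> 0)"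
  define R where "R = (\<lambda>\<epsilon>. stage_residual dx dt (un \<epsilon>))"
  \<comment> \<open>At a singular Jacobian \<open>matrix_inv\<close> is an unspecified matrix. The
    \<open>\<epsilon>\<close> chosen at the end makes all Jacobians involved invertible.\<close>
  define U where "U = (\<lambda>\<epsilon>. rec_nat (\<epsilon> *\<^sub>R w)
    (\<lambda>j u. u + - (matrix_inv (jacobian (R \<epsilon>) (at u)) *v R \<epsilon> u)))"
  define J where "J = (\<lambda>j \<epsilon>. jacobian (R \<epsilon>) (at (U \<epsilon> j)))"
  define d where "d = (\<lambda>j \<epsilon>. - (matrix_inv (J j \<epsilon>) *v R \<epsilon> (U \<epsilon> j)))"
  \<comment> \<open>The order in \<open>\<epsilon>\<close> of the residual and of the step. It
    starts at 2 by the choice of \<open>un\<close> and doubles by quadratic convergence.\<close>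
  define m :: "nat \<Rightarrow> nat" where "m = (\<lambda>j. 2 ^ Suc j)"
  have U_0: "U \<epsilon> 0 = \<epsilon> *\<^sub>R w" and U_Suc: "U \<epsilon> (Suc j) = U \<epsilon> j + d j \<epsilon>" for \<epsilon> j
    by (simp_all add: U_def d_def J_def)
  have J: "J j \<epsilon> *v h = h + (2 * dt) *\<^sub>R burgers_form dx (U \<epsilon> j) h" for j \<epsilon> h
    by (simp add: J_def R_def jacobian_stage_residual)
  have newton: "J j \<epsilon> *v d j \<epsilon> + R \<epsilon> (U \<epsilon> j) = 0" if "invertible (J j \<epsilon>)" for j \<epsilon>
    using matrix_inv_right[OF that]
    by (simp add: d_def linear_neg[OF matrix_vector_mul_linear] matrix_vector_mul_assoc)
  let ?F = "at_right (0 :: real)"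
  have pos: "eventually (\<lambda>\<epsilon>::real. \<epsilon> > 0) ?F" by (simp add: eventually_at_right_less)
  have id0: "((\<lambda>\<epsilon>. \<epsilon>) \<longlongrightarrow> (0::real)) ?F" by (rule tendsto_ident_at)
  have "((\<lambda>\<epsilon>. U \<epsilon> j /\<^sub>R \<epsilon>) \<longlongrightarrow> w) ?F \<and>
      ((\<lambda>\<epsilon>. R \<epsilon> (U \<epsilon> j) /\<^sub>R \<epsilon> ^ m j) \<longlongrightarrow> - \<delta> j) ?F \<and>
      eventually (\<lambda>\<epsilon>. invertible (J j \<epsilon>)) ?F \<and> ((\<lambda>\<epsilon>. d j \<epsilon> /\<^sub>R \<epsilon> ^ m j) \<longlongrightarrow> \<delta> j) ?F" for j
  proof (induction j)
    have step: "eventually (\<lambda>\<epsilon>. invertible (J j \<epsilon>)) ?F \<and> ((\<lambda>\<epsilon>. d j \<epsilon> /\<^sub>R \<epsilon> ^ m j) \<longlongrightarrow> \<delta> j) ?F"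
      if "((\<lambda>\<epsilon>. U \<epsilon> j /\<^sub>R \<epsilon>) \<longlongrightarrow> w) ?F"
        "((\<lambda>\<epsilon>. R \<epsilon> (U \<epsilon> j) /\<^sub>R \<epsilon> ^ m j) \<longlongrightarrow> - \<delta> j) ?F" for j
    proof -
      have "((\<lambda>\<epsilon>. \<epsilon> *\<^sub>R (U \<epsilon> j /\<^sub>R \<epsilon>)) \<longlongrightarrow> 0) ?F"
        using tendsto_scaleR[OF id0 that(1)] by simp
      then have "((\<lambda>\<epsilon>. U \<epsilon> j) \<longlongrightarrow> 0) ?F"
        by (rule Lim_transform_eventually) (use pos in \<open>auto elim: eventually_mono\<close>)
      from small_newton_step[OF this that(2) J] show ?thesis by (simp add: d_def)
    qed
    {
      case 0
      have "((\<lambda>\<epsilon>. U \<epsilon> 0 /\<^sub>R \<epsilon>) \<longlongrightarrow> w) ?F"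
        by (rule Lim_transform_eventually[OF tendsto_const])
           (use pos in \<open>auto elim: eventually_mono simp: U_0\<close>)
      moreover have "((\<lambda>\<epsilon>. R \<epsilon> (U \<epsilon> 0) /\<^sub>R \<epsilon> ^ m 0) \<longlongrightarrow> - \<delta> 0) ?F"
        by (rule Lim_transform_eventually[OF tendsto_const])
           (use pos in \<open>eventually_elim, simp add: U_0 R_def stage_residual_eq un_def m_def flip: power_mult_distrib\<close>)
      ultimately show ?case using step by blast
    next
      case (Suc j)
      \<comment> \<open>The step has order at least 2, so it does not disturb the leading term
        \<open>\<epsilon> *\<^sub>R w\<close> of the iterate.\<close>
      have "((\<lambda>\<epsilon>. U \<epsilon> j /\<^sub>R \<epsilon> + \<epsilon> ^ (m j - 1) *\<^sub>R (d j \<epsilon> /\<^sub>R \<epsilon> ^ m j)) \<longlongrightarrow> w + 0 ^ (m j - 1) *\<^sub>R \<delta> j) ?F"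
        using Suc by (intro tendsto_intros) auto
      moreover have "m j \<ge> 2" by (simp add: m_def)
      ultimately have "((\<lambda>\<epsilon>. U \<epsilon> j /\<^sub>R \<epsilon> + \<epsilon> ^ (m j - 1) *\<^sub>R (d j \<epsilon> /\<^sub>R \<epsilon> ^ m j)) \<longlongrightarrow> w) ?F"
        by (simp add: power_0_left)
      moreover have "eventually (\<lambda>\<epsilon>. U \<epsilon> j /\<^sub>R \<epsilon> + \<epsilon> ^ (m j - 1) *\<^sub>R (d j \<epsilon> /\<^sub>R \<epsilon> ^ m j) = U \<epsilon> (Suc j) /\<^sub>R \<epsilon>) ?F"
        using pos
      proof eventually_elim
        case (elim \<epsilon>)
        have "\<epsilon> ^ m j = \<epsilon> ^ (m j - 1) * \<epsilon>"
          using \<open>m j \<ge> 2\<close> by (metis power_minus_mult not_numeral_le_zero not_gr_zero)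
        with elim show ?case by (simp add: U_Suc scaleR_add_right field_simps)
      qed
      ultimately have U: "((\<lambda>\<epsilon>. U \<epsilon> (Suc j) /\<^sub>R \<epsilon>) \<longlongrightarrow> w) ?F"
        by (rule Lim_transform_eventually)
      have "((\<lambda>\<epsilon>. dt *\<^sub>R burgers_form dx (d j \<epsilon> /\<^sub>R \<epsilon> ^ m j) (d j \<epsilon> /\<^sub>R \<epsilon> ^ m j)) \<longlongrightarrow> - \<delta> (Suc j)) ?F"
        using Suc unfolding \<delta> by (auto intro!: tendsto_eq_intros tendsto)
      moreover have "eventually (\<lambda>\<epsilon>. dt *\<^sub>R burgers_form dx (d j \<epsilon> /\<^sub>R \<epsilon> ^ m j) (d j \<epsilon> /\<^sub>R \<epsilon> ^ m j)
          = R \<epsilon> (U \<epsilon> (Suc j)) /\<^sub>R \<epsilon> ^ m (Suc j)) ?F"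
        using Suc[THEN conjunct2, THEN conjunct2, THEN conjunct1]
      proof eventually_elim
        case (elim \<epsilon>)
        have "R \<epsilon> (U \<epsilon> (Suc j)) = dt *\<^sub>R burgers_form dx (d j \<epsilon>) (d j \<epsilon>)"
          using newton[OF elim] unfolding U_Suc R_def J_def by (rule stage_residual_newton)
        moreover have "\<epsilon> ^ m (Suc j) = \<epsilon> ^ m j * \<epsilon> ^ m j"
          by (simp add: m_def mult_2 power_add)
        ultimately show ?case by (simp add: scaleR_left scaleR_right mult_ac)
      qed
      ultimately have "((\<lambda>\<epsilon>. R \<epsilon> (U \<epsilon> (Suc j)) /\<^sub>R \<epsilon> ^ m (Suc j)) \<longlongrightarrow> - \<delta> (Suc j)) ?F"
        by (rule Lim_transform_eventually)
      with U show ?case using step by blast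
    }
  qed
  then have U: "((\<lambda>\<epsilon>. U \<epsilon> j /\<^sub>R \<epsilon>) \<longlongrightarrow> w) ?F"
    and inv: "eventually (\<lambda>\<epsilon>. invertible (J j \<epsilon>)) ?F"
    and d: "((\<lambda>\<epsilon>. d j \<epsilon> /\<^sub>R \<epsilon> ^ m j) \<longlongrightarrow> \<delta> j) ?F" for j
    by blast+
  \<comment> \<open>The entropy change times \<open>s\<close>, up to positive factors:
    \<open>2 * dx\<close> is dropped and the powers of \<open>\<epsilon>\<close> are divided out, so
    that the limit is positive by assumption.\<close>
  let ?L = "\<lambda>\<epsilon>. s * (dt * ((U \<epsilon> k /\<^sub>R \<epsilon>) \<bullet> burgers_form dx (d k \<epsilon> /\<^sub>R \<epsilon> ^ m k) (d k \<epsilon> /\<^sub>R \<epsilon> ^ m k)))"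
  have "(?L \<longlongrightarrow> s * (dt * (w \<bullet> burgers_form dx (\<delta> k) (\<delta> k)))) ?F"
    by (intro tendsto_intros tendsto U d)
  then have "eventually (\<lambda>\<epsilon>. ?L \<epsilon> > 0) ?F"
    using w by (rule order_tendstoD)
  moreover have "eventually (\<lambda>\<epsilon>. \<forall>j\<in>{..k}. invertible (J j \<epsilon>)) ?F"
    by (intro eventually_ball_finite) (auto simp: inv)
  ultimately have "eventually (\<lambda>\<epsilon>. ?L \<epsilon> > 0 \<and> (\<forall>j\<in>{..k}. invertible (J j \<epsilon>)) \<and> \<epsilon> > 0) ?F"
    using pos by eventually_elim blast
  from eventually_happens'[OF trivial_limit_at_right_real this]
  obtain \<epsilon> where \<epsilon>: "?L \<epsilon> > 0" "\<And>j. j \<le> k \<Longrightarrow> invertible (J j \<epsilon>)" "\<epsilon> > 0"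
    by (metis atMost_iff)
  have "newton_iterates (stage_residual dx dt (un \<epsilon>)) (k + 1) (U \<epsilon>)"
    unfolding newton_iterates_def
    using newton[OF \<epsilon>(2)] by (auto simp: U_Suc less_Suc_eq_le R_def J_def)
  moreover have "\<forall>j\<le>k. invertible (jacobian (stage_residual dx dt (un \<epsilon>)) (at (U \<epsilon> j)))"
    using \<epsilon>(2) by (simp add: J_def R_def)
  moreover have "s * (entropy dx (2 *\<^sub>R U \<epsilon> (k + 1) - un \<epsilon>) - entropy dx (un \<epsilon>)) > 0"
  proof -
    have "entropy dx (2 *\<^sub>R U \<epsilon> (k + 1) - un \<epsilon>) - entropy dx (un \<epsilon>)
        = 2 * dx * dt * (U \<epsilon> k \<bullet> burgers_form dx (d k \<epsilon>) (d k \<epsilon>))"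
      using entropy_newton[OF assms(1) newton[OF \<epsilon>(2)[of k], unfolded R_def J_def]]
      by (simp add: U_Suc)
    moreover define x where "x = s * (dt * (U \<epsilon> k \<bullet> burgers_form dx (d k \<epsilon>) (d k \<epsilon>)))"
    moreover have "x * inverse (\<epsilon> * \<epsilon> ^ m k * \<epsilon> ^ m k) > 0"
      using \<epsilon>(1) by (simp only: x_def scaleR_left scaleR_right inner_scaleR_left inner_scaleR_right
          inverse_mult_distrib mult_ac)
    then have "x > 0"
      by (rule zero_less_mult_pos2) (simp add: \<epsilon>(3))
    then have "2 * dx * x > 0" using assms(1) by simp
    ultimately show ?thesis by (simp add: mult_ac)
  qed
  ultimately show ?thesis
    by blast
qed

section \<open>The entropy identity, indefiniteness, and both signs of the entropy error\<close>

theorem proposition1: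
  fixes dx :: real and k :: nat
  assumes "dx > 0"
  shows
    "(\<forall>(dt :: real) (un :: real ^ 'n::nontriv mod_ring) U.
        newton_iterates (stage_residual dx dt un) (k + 1) U \<longrightarrow>
        (let dU = U (k + 1) - U k
         in entropy dx (2 *\<^sub>R U (k + 1) - un) =
              entropy dx un - 2 * dx * dt * (dU \<bullet> (M_mat dx (U k) *v dU)))) \<and>
     (CARD('n) \<ge> 5 \<longrightarrow>
        (\<forall>W :: real ^ 'n mod_ring. (\<exists>i j. W $ i \<noteq> W $ j) \<longrightarrow> indefinite (M_mat dx W))) \<and>
     (CARD('n) \<ge> 5 \<longrightarrow>
        (\<forall>dt > 0.
          (\<exists>(un :: real ^ 'n mod_ring) U.
             newton_iterates (stage_residual dx dt un) (k + 1) U \<and>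
             (\<forall>j\<le>k. invertible (jacobian (stage_residual dx dt un) (at (U j)))) \<and>
             entropy dx (2 *\<^sub>R U (k + 1) - un) > entropy dx un) \<and>
          (\<exists>(un :: real ^ 'n mod_ring) U.
             newton_iterates (stage_residual dx dt un) (k + 1) U \<and>
             (\<forall>j\<le>k. invertible (jacobian (stage_residual dx dt un) (at (U j)))) \<and>
             entropy dx (2 *\<^sub>R U (k + 1) - un) < entropy dx un)))"
proof -
  define good where "good = (\<lambda>dt (un :: real ^ 'n mod_ring) U.
    newton_iterates (stage_residual dx dt un) (k + 1) U \<and>
    (\<forall>j\<le>k. invertible (jacobian (stage_residual dx dt un) (at (U j)))))"
  have id: "entropy dx (2 *\<^sub>R U (k + 1) - un) = entropy dx un
      - 2 * dx * dt * ((U (k + 1) - U k) \<bullet> (M_mat dx (U k) *v (U (k + 1) - U k)))"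
    if "newton_iterates (stage_residual dx dt un) (k + 1) U"
    for dt and un :: "real ^ 'n mod_ring" and U
  proof -
    have "jacobian (stage_residual dx dt un) (at (U k)) *v (U (Suc k) - U k)
        + stage_residual dx dt un (U k) = 0"
      using that by (simp add: newton_iterates_def)
    from entropy_newton[OF assms this] show ?thesis
      by (simp add: inner_burgers_form)
  qed
  have ex: "\<exists>un U. good dt un U \<and>
      s * (entropy dx (2 *\<^sub>R U (k + 1) - un) - entropy dx un) > 0"
    if N: "CARD('n) \<ge> 5" and "dt > 0" "s \<noteq> 0" for dt s :: real
  proof -
    obtain f c and q :: int where f: "prime q" "\<not> q dvd c" "int_periodic (int CARD('n)) f"
      "\<not> q dvd f 1" "\<And>x. [int_burgers f x = c * f x] (mod q)"
      by (rule int_burgers_eigenfunction[OF N]) (rule that)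
    define \<delta> :: "nat \<Rightarrow> real ^ 'n mod_ring"
      where "\<delta> = rec_nat (grid_of f) (\<lambda>j v. (- dt) *\<^sub>R burgers_form dx v v)"
    have \<delta>: "\<delta> 0 = grid_of f" "\<delta> (Suc j) = (- dt) *\<^sub>R burgers_form dx (\<delta> j) (\<delta> j)" for j
      by (simp_all add: \<delta>_def)
    \<comment> \<open>The index is one beyond the last step, because \<open>\<delta> (Suc k)\<close>
      is a multiple of \<open>Q(\<delta> k)\<close>, the vector that must not vanish.\<close>
    have "\<delta> (Suc k) \<noteq> 0"
      using int_burgers_orbit[where a = "- dt" and \<delta> = \<delta> and dx = dx, OF f(1,2) _ _ f(3,4,5) \<delta>]
        \<open>dt > 0\<close> assms by simp
    then have "burgers_form dx (\<delta> k) (\<delta> k) \<noteq> 0"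
      by (auto simp: \<delta>(2))
    then have "s\<^sup>2 * (dt * (burgers_form dx (\<delta> k) (\<delta> k) \<bullet> burgers_form dx (\<delta> k) (\<delta> k))) > 0"
      using that by (intro mult_pos_pos) auto
    \<comment> \<open>The direction \<open>w\<close> is \<open>s\<close> times
      \<open>Q(\<delta> k)\<close>, which makes the required product a positive multiple of a
      squared norm.\<close>
    then have "s * (dt * ((s *\<^sub>R burgers_form dx (\<delta> k) (\<delta> k)) \<bullet> burgers_form dx (\<delta> k) (\<delta> k))) > 0"
      by (simp add: power2_eq_square mult_ac)
    from newton_entropy_sign[OF assms \<delta>(2) this] show ?thesis
      unfolding good_def by blast
  qed
  have "\<exists>un U. good dt un U \<and> entropy dx (2 *\<^sub>R U (k + 1) - un) > entropy dx un"
    "\<exists>un U. good dt un U \<and> entropy dx (2 *\<^sub>R U (k + 1) - un) < entropy dx un"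
    if "CARD('n) \<ge> 5" "dt > 0" for dt
    using ex[OF that, of 1] ex[OF that, of "-1"] by simp_all
  then show ?thesis
    using id indefinite_M_mat[OF assms, where 'n = 'n] unfolding good_def Let_def by blast
qed

end
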